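(* Let $g:\mathbb{R}^2\times\mathbb{R}\to\mathbb{R}$, $g(u,Z') := s(u)f(Z')$, and for $v,w\in\mathbb{R}^2$ let $q_{v,w}:\mathbb{R}^2\times\mathbb{R}\to\mathbb{C}$, $q_{v,w}(u,Z') := p_{Z+Z'}(v+u)\,p_{Z+Z'}^*(w+u)$. Assume that $s$ and $f$ are differentiable with $$\sup_{v,w\in A}\|g\nabla q_{v,w}\|_\infty<\infty\qquad\text{and}\qquad \|\nabla g\|_\infty<\infty .$$ Then there exists a sequence $(T_{Z,N})_{N\in\mathbb{N}}$ of functions $\mathbb{R}^2\times\mathbb{R}^2\to\mathbb{C}$ converging uniformly to $T_Z$ with the following properties: (i) $T_{Z,N}$ is continuous and bounded on $A\times A$ and zero on $(\mathbb{R}^2\times\mathbb{R}^2)\setminus(A\times A)$ for all $N\in\mathbb{N}$. (ii) For all $N\in\mathbb{N}$ and $j\in\{1,\ldots,N\}$ there are functions $t_{Z,N,j}:\mathbb{R}^2\to\mathbb{C}$ such that $t_{Z,N,j}$ is continuous and bounded on $A$, zero on $\mathbb{R}^2\setminus A$, and $$T_{Z,N}(v,w)=\sum_{j=1}^N t_{Z,N,j}(v)\,t_{Z,N,j}^*(w)\qquad\text{for all } v,w\in\mathbb{R}^2 .$$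
   Context: A superscript $*$ denotes complex conjugation. Fix constants $\lambda>0$, $C_s\in\mathbb{R}$, $\alpha_{\max}>0$ and a focus value $Z\in\mathbb{R}$. Let $s\in L^1(\mathbb{R}^2,\mathbb{R})$ and $f\in L^1(\mathbb{R},\mathbb{R})$ be probability density functions. For $z\in\mathbb{R}$ and $v\in\mathbb{R}^2$ (with Euclidean norm $|v|$) put $\chi_z(v):=\frac12 z\lambda|v|^2+\frac14 C_s\lambda^3|v|^4$ and $p_z(v):=\exp(-2\pi i\chi_z(v))$. Let $A:=\{v\in\mathbb{R}^2: |v|<\alpha_{\max}/\lambda\}$ and let $a:\mathbb{R}^2\to\mathbb{R}$ be the indicator function of $A$. The transmission cross-coefficient (TCC) is $T_Z:\mathbb{R}^2\times\mathbb{R}^2\to\mathbb{C}$, $$T_Z(v,w):=a(v)a^*(w)\int_{\mathbb{R}}\int_{\mathbb{R}^2}s(u)f(Z')\,p_{Z+Z'}(v+u)\,p_{Z+Z'}^*(w+u)\,\mathrm{d}u\,\mathrm{d}Z'.$$ Gradients of $g$ and $q_{v,w}$ are taken with respect to $(u,Z')\in\mathbb{R}^2\times\mathbb{R}$. For a vector-valued function $\alpha:\mathbb{R}^n\to\mathbb{C}^m$, $\|\alpha\|_\infty:=\sup_{x\in\mathbb{R}^n}\|\alpha(x)\|_\infty$. *)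

theory Defs
  imports "HOL-Analysis.Analysis"
begin

text \<open>
  Elements of \<open>L\<^sup>1\<close> that are probability densities. Nonnegativity is required almost everywhere
  only, as is natural for \<open>L\<^sup>1\<close>; for continuous functions it then holds everywhere.
\<close>
definition prob_density :: "('a::euclidean_space \<Rightarrow> real) \<Rightarrow> bool" where
  "prob_density h \<longleftrightarrow>
     integrable lborel h \<and> (AE x in lborel. 0 \<le> h x) \<and> (LINT x|lborel. h x) = 1"

definition chi :: "real \<Rightarrow> real \<Rightarrow> real \<Rightarrow> real^2 \<Rightarrow> real" where
  "chi lam Cs z v = 1/2 * z * lam * norm v ^ 2 + 1/4 * Cs * lam ^ 3 * norm v ^ 4"

definition phase :: "real \<Rightarrow> real \<Rightarrow> real \<Rightarrow> real^2 \<Rightarrow> complex" where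
  "phase lam Cs z v = exp (- 2 * of_real pi * \<i> * of_real (chi lam Cs z v))"

definition aperture :: "real \<Rightarrow> real \<Rightarrow> (real^2) set" where
  "aperture lam amax = {v. norm v < amax / lam}"

definition TCC ::
  "real \<Rightarrow> real \<Rightarrow> real \<Rightarrow> real \<Rightarrow> (real^2 \<Rightarrow> real) \<Rightarrow> (real \<Rightarrow> real) \<Rightarrow> (real^2) \<times> (real^2) \<Rightarrow> complex"
where
  "TCC lam Cs amax Z s f = (\<lambda>(v, w).
     of_real (indicator (aperture lam amax) v) * cnj (of_real (indicator (aperture lam amax) w)) *
     (LINT Z'|lborel. LINT u|lborel.
        of_real (s u) * of_real (f Z') *
        phase lam Cs (Z + Z') (v + u) * cnj (phase lam Cs (Z + Z') (w + u))))"

definition joint_density :: "(real^2 \<Rightarrow> real) \<Rightarrow> (real \<Rightarrow> real) \<Rightarrow> (real^2) \<times> real \<Rightarrow> real" where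
  "joint_density s f = (\<lambda>(u, Z'). s u * f Z')"

definition phase_prod ::
  "real \<Rightarrow> real \<Rightarrow> real \<Rightarrow> real^2 \<Rightarrow> real^2 \<Rightarrow> (real^2) \<times> real \<Rightarrow> complex"
where
  "phase_prod lam Cs Z v w =
     (\<lambda>(u, Z'). phase lam Cs (Z + Z') (v + u) * cnj (phase lam Cs (Z + Z') (w + u)))"

text \<open>
  The gradient with respect to \<open>(u, Z')\<close>, as the vector of the three partial derivatives. It is
  polymorphic in the codomain so as to cover both real- and complex-valued functions, and it is
  meaningful only at points where the function is differentiable.
\<close>
definition grad ::
  "((real^2) \<times> real \<Rightarrow> 'b::real_normed_vector) \<Rightarrow> (real^2) \<times> real \<Rightarrow> 'b^3"
where
  "grad F x = vector
     [frechet_derivative F (at x) (axis 1 1, 0),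
      frechet_derivative F (at x) (axis 2 1, 0),
      frechet_derivative F (at x) (0, 1)]"

text \<open>
  The maximum norm on \<open>m\<close>-tuples. For complex entries this is not the library's \<open>infnorm\<close>, which
  takes real and imaginary parts as separate coordinates.
\<close>
definition max_norm :: "'b::real_normed_vector^'m \<Rightarrow> real" where
  "max_norm y = Max (range (\<lambda>i. norm (y $ i)))"

definition sup_norm :: "('a \<Rightarrow> 'b::real_normed_vector^'m) \<Rightarrow> ennreal" where
  "sup_norm F = (SUP x. ennreal (max_norm (F x)))"

end

theory Submission imports Defs begin

text \<open>
  The cross-coefficient is a Gram kernel. Writing \<open>\<phi>\<^sub>x(v) = p\<^bsub>Z+Z'\<^esub>(v + u)\<close> for \<open>x = (Z', u)\<close>, and \<open>\<mu>\<close>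
  for the probability measure on \<open>\<real> \<times> \<real>\<^sup>2\<close> with density \<open>f(Z') s(u)\<close>, Fubini gives
  \<open>T\<^sub>Z(v, w) = a(v) a(w) \<integral> \<phi>\<^sub>x(v) \<phi>\<^sub>x(w)\<^sup>* d\<mu>(x)\<close>. A Riemann sum of this integral has the form
  \<open>\<Sum>\<^sub>k \<mu>(B\<^sub>k) \<phi>\<^bsub>d\<^sub>k\<^esub>(v) \<phi>\<^bsub>d\<^sub>k\<^esub>(w)\<^sup>*\<close>, and since \<open>\<mu>(B\<^sub>k) \<ge> 0\<close> its square root can be moved into the
  two factors: every such sum is already of the required finite-rank form.

  It remains to make the error uniform in \<open>v\<close> and \<open>w\<close>. The aperture lies in a compact ball, so
  \<open>x \<mapsto> \<phi>\<^sub>x\<close> is continuous for the supremum norm over that ball, and \<open>|\<phi>\<^sub>x| \<le> 1\<close>. Hence, for given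
  \<open>\<delta>\<close>, the parameter space splits into countably many pieces \<open>B\<^sub>k\<close> on which \<open>\<phi>\<^sub>x\<close> stays
  within \<open>\<delta>\<close> of the feature \<open>\<phi>\<^bsub>d\<^sub>k\<^esub>\<close> of a sample point. As \<open>\<mu>\<close> is finite, finitely many pieces can be
  kept so that the others together carry mass at most \<open>\<delta>\<close>, and the resulting finite
  sum has error at most \<open>2\<delta>\<mu>(\<real> \<times> \<real>\<^sup>2) + \<delta>\<close> (\<open>Gram_kernel_finite_rank_approx\<close>).

  The number of terms needed for a given accuracy is not controlled, whereas the \<open>N\<close>-th
  approximant must have exactly \<open>N\<close> terms. Padding with zeros makes the sets of \<open>N\<close>-term kernels
  increase with \<open>N\<close>, and a sequence can then be chosen that is as accurate as \<open>N\<close> terms permit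
  (\<open>uniform_limit_from_increasing_sets\<close>).
\<close>

section \<open>Riemann sums for Gram kernels\<close>

text \<open>
  The two factors of \<open>a b\<^sup>*\<close> are replaced one after the other, each at cost at most \<open>\<delta>\<close>.
\<close>
lemma norm_mult_cnj_diff_le:
  fixes a b c d :: complex
  assumes "norm (a - c) \<le> \<delta>" "norm (b - d) \<le> \<delta>" "norm b \<le> 1" "norm c \<le> 1"
  shows "norm (a * cnj b - c * cnj d) \<le> 2 * \<delta>"
proof -
  have eq: "a * cnj b - c * cnj d = (a - c) * cnj b + c * cnj (b - d)"
    by (simp add: algebra_simps)
  have "norm ((a - c) * cnj b) \<le> \<delta> * 1"
    unfolding norm_mult complex_mod_cnj
    by (rule mult_mono) (use assms in \<open>auto intro: order_trans[OF norm_ge_zero]\<close>)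
  moreover have "norm (c * cnj (b - d)) \<le> 1 * \<delta>"
    unfolding norm_mult complex_mod_cnj
    by (rule mult_mono) (use assms in auto)
  ultimately show ?thesis
    unfolding eq by (intro order_trans[OF norm_triangle_ineq]) auto
qed

lemma continuous_on_section:
  assumes "continuous_on (UNIV \<times> C) (\<lambda>(x, v). \<phi> x v)" "v \<in> C"
  shows "continuous_on UNIV (\<lambda>x. \<phi> x v)"
  using continuous_on_compose2[OF assms(1), of UNIV "\<lambda>x. (x, v)"] assms(2)
  by (simp add: continuous_on_Pair image_subset_iff)

text \<open>
  The mesh of the Riemann sum: \<open>\<kappa>\<close> assigns to every parameter \<open>x\<close> the number of a sample point \<open>d k\<close>
  whose feature is \<open>\<delta>\<close>-close to that of \<open>x\<close>, uniformly over \<open>C\<close>. Compactness of \<open>C\<close> (the tube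
  lemma) makes \<open>x \<mapsto> \<phi> x\<close> continuous for the supremum norm, so a countable dense set of sample
  points suffices, and taking the first admissible one keeps the choice measurable.
\<close>
lemma countable_feature_mesh:
  fixes \<phi> :: "'x::second_countable_topology \<Rightarrow> 'v::topological_space \<Rightarrow> complex"
  assumes C: "compact C" and cont: "continuous_on (UNIV \<times> C) (\<lambda>(x, v). \<phi> x v)" and "\<delta> > 0"
  obtains d :: "nat \<Rightarrow> 'x" and \<kappa> :: "'x \<Rightarrow> nat"
  where "\<kappa> \<in> borel \<rightarrow>\<^sub>M count_space UNIV"
    and "\<And>x v. v \<in> C \<Longrightarrow> norm (\<phi> x v - \<phi> (d (\<kappa> x)) v) \<le> \<delta>"
proof -
  obtain D :: "'x set" where D: "countable D" "\<And>X. open X \<Longrightarrow> X \<noteq> {} \<Longrightarrow> \<exists>d\<in>D. d \<in> X"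
    using countable_dense_exists by metis
  have "D \<noteq> {}" using D(2)[of UNIV] by auto
  define d where "d = from_nat_into D"
  define close where "close k x \<longleftrightarrow> (\<forall>v\<in>C. norm (\<phi> x v - \<phi> (d k) v) \<le> \<delta>)" for k x
  note cont_x = continuous_on_section[OF cont]
  have closed_close: "closed {x. close k x}" for k
  proof -
    have "closed {x. norm (\<phi> x v - \<phi> (d k) v) \<le> \<delta>}" if "v \<in> C" for v
      using cont_x[OF that] by (intro closed_Collect_le continuous_intros) auto
    moreover have "{x. close k x} = (\<Inter>v\<in>C. {x. norm (\<phi> x v - \<phi> (d k) v) \<le> \<delta>})"
      by (auto simp: close_def)
    ultimately show ?thesis by auto
  qed
  have ex_close: "\<exists>k. close k x" for x
  proof -
    obtain X where X: "x \<in> X" "open X"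
      and near: "\<forall>x'\<in>X \<inter> UNIV. \<forall>v\<in>C. dist (case (x', v) of (x, v) \<Rightarrow> \<phi> x v) (case (x, v) of (x, v) \<Rightarrow> \<phi> x v) \<le> \<delta>"
      using continuous_on_prod_compactE[OF cont C UNIV_I \<open>\<delta> > 0\<close>, of x] by blast
    obtain y where "y \<in> D" "y \<in> X" using D(2)[of X] X by auto
    moreover obtain k where "d k = y"
      using \<open>y \<in> D\<close> D(1) from_nat_into_surj unfolding d_def by metis
    ultimately have "close k x"
      using near by (auto simp: close_def dist_norm norm_minus_commute)
    then show ?thesis ..
  qed
  define \<kappa> where "\<kappa> x = (LEAST k. close k x)" for x
  show thesis
  proof
    have "Measurable.pred borel (close k)" for k
      using borel_closed[OF closed_close[of k]] by (simp add: pred_def)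
    then show "\<kappa> \<in> borel \<rightarrow>\<^sub>M count_space UNIV"
      unfolding \<kappa>_def by (rule measurable_Least)
    show "norm (\<phi> x v - \<phi> (d (\<kappa> x)) v) \<le> \<delta>" if "v \<in> C" for x v
      using LeastI_ex[OF ex_close[of x]] that by (auto simp: \<kappa>_def close_def)
  qed
qed

text \<open>
  The weights \<open>c k\<close> are the masses of the cells of the mesh, whence their nonnegativity. Truncating
  to \<open>n\<close> cells costs the mass of the remaining ones, which vanishes in the limit.
\<close>
lemma Gram_kernel_finite_rank_approx:
  fixes \<phi> :: "'x::second_countable_topology \<Rightarrow> 'v::topological_space \<Rightarrow> complex"
  assumes "finite_measure M" and sets_M [measurable_cong]: "sets M = sets borel"
    and C: "compact C" and cont: "continuous_on (UNIV \<times> C) (\<lambda>(x, v). \<phi> x v)"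
    and bound: "\<And>x v. v \<in> C \<Longrightarrow> norm (\<phi> x v) \<le> 1" and "e > 0"
  obtains n :: nat and c :: "nat \<Rightarrow> real" and d :: "nat \<Rightarrow> 'x"
  where "\<And>k. c k \<ge> 0"
    and "\<And>v w. v \<in> C \<Longrightarrow> w \<in> C \<Longrightarrow>
           norm ((\<integral>x. \<phi> x v * cnj (\<phi> x w) \<partial>M) - (\<Sum>k<n. of_real (c k) * (\<phi> (d k) v * cnj (\<phi> (d k) w)))) \<le> e"
proof -
  interpret finite_measure M by fact
  have space_M [simp]: "space M = UNIV"
    using sets_eq_imp_space_eq[OF sets_M] by simp
  \<comment> \<open>chosen so that the total error \<open>2 * \<delta> * \<mu> + \<delta>\<close> is at most \<open>e\<close>\<close>
  define \<delta> where "\<delta> = e / (2 * measure M (space M) + 1)"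
  have pos: "2 * measure M (space M) + 1 > 0"
    using measure_nonneg[of M "space M"] by linarith
  then have "\<delta> > 0" using \<open>e > 0\<close> by (simp add: \<delta>_def)
  obtain d :: "nat \<Rightarrow> 'x" and \<kappa> where \<kappa>: "\<kappa> \<in> borel \<rightarrow>\<^sub>M count_space UNIV"
    and close: "\<And>x v. v \<in> C \<Longrightarrow> norm (\<phi> x v - \<phi> (d (\<kappa> x)) v) \<le> \<delta>"
    by (rule countable_feature_mesh[OF C cont \<open>\<delta> > 0\<close>]) (rule that)
  have \<kappa>_M [measurable]: "\<kappa> \<in> M \<rightarrow>\<^sub>M count_space UNIV"
    using \<kappa> by (simp add: measurable_cong_sets[OF sets_M refl])
  define tail where "tail n = {x. n \<le> \<kappa> x}" for n
  have tail_sets [measurable]: "tail n \<in> sets M" for n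
  proof -
    have "{x \<in> space M. n \<le> \<kappa> x} \<in> sets M" by measurable
    then show ?thesis by (simp add: tail_def)
  qed
  have "(\<lambda>n. measure M (tail n)) \<longlonglongrightarrow> measure M (\<Inter>n. tail n)"
    by (rule finite_Lim_measure_decseq) (auto simp: decseq_def tail_def)
  moreover have "x \<notin> tail (Suc (\<kappa> x))" for x
    by (simp add: tail_def)
  then have "(\<Inter>n. tail n) = {}" by blast
  ultimately have "(\<lambda>n. measure M (tail n)) \<longlonglongrightarrow> 0" by simp
  then have "\<forall>\<^sub>F n in sequentially. measure M (tail n) < \<delta>"
    using \<open>\<delta> > 0\<close> by (rule order_tendstoD(2))
  then obtain n where n: "measure M (tail n) < \<delta>"
    by (meson eventually_sequentially order_refl)
  define cell where "cell k = {x. \<kappa> x = k}" for k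
  have cell_sets [measurable]: "cell k \<in> sets M" for k
  proof -
    have "{x \<in> space M. \<kappa> x = k} \<in> sets M" by measurable
    then show ?thesis by (simp add: cell_def)
  qed
  show thesis
  proof
    show "measure M (cell k) \<ge> 0" for k by simp
  next
    fix v w assume v: "v \<in> C" and w: "w \<in> C"
    define G where "G x = \<phi> x v * cnj (\<phi> x w)" for x
    define S where "S x = (\<Sum>k<n. indicator (cell k) x *\<^sub>R G (d k))" for x
    note cont_x = continuous_on_section[OF cont]
    have "G \<in> borel_measurable borel"
      unfolding G_def
      by (intro borel_measurable_continuous_onI continuous_intros cont_x v w)
    then have G_meas: "G \<in> borel_measurable M"
      by (simp add: measurable_cong_sets[OF sets_M refl])
    have normG: "norm (G x) \<le> 1" for x
      using bound[OF v, of x] bound[OF w, of x] by (simp add: G_def norm_mult mult_le_one)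
    have int_G: "integrable M G"
      by (rule integrable_const_bound[where B = 1]) (use normG G_meas in auto)
    have int_cell: "integrable M (\<lambda>x. indicator (cell k) x *\<^sub>R G (d k))" for k
      by (simp add: less_top[symmetric])
    then have int_S: "integrable M S"
      unfolding S_def by (rule Bochner_Integration.integrable_sum)
    have "indicator (cell k) x *\<^sub>R G (d k) = (if k = \<kappa> x then G (d k) else 0)" for k x
      by (simp add: cell_def)
    then have "S x = (if \<kappa> x < n then G (d (\<kappa> x)) else 0)" for x
      by (simp add: S_def)
    then have pointwise: "norm (G x - S x) \<le> 2 * \<delta> + indicator (tail n) x" for x
      using norm_mult_cnj_diff_le[OF close[OF v, of x] close[OF w, of x] bound[OF w] bound[OF v]]
        normG[of x] \<open>\<delta> > 0\<close>
      by (auto simp: G_def tail_def indicator_def)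
    have "(\<integral>x. S x \<partial>M) = (\<Sum>k<n. of_real (measure M (cell k)) * G (d k))"
      unfolding S_def Bochner_Integration.integral_sum[OF int_cell]
      by (simp add: scaleR_conv_of_real)
    then have "norm ((\<integral>x. G x \<partial>M) - (\<Sum>k<n. of_real (measure M (cell k)) * G (d k)))
        = norm (\<integral>x. G x - S x \<partial>M)"
      by (simp add: Bochner_Integration.integral_diff[OF int_G int_S])
    also have "\<dots> \<le> (\<integral>x. norm (G x - S x) \<partial>M)"
      by (rule integral_norm_bound)
    also have "\<dots> \<le> (\<integral>x. 2 * \<delta> + indicator (tail n) x \<partial>M)"
      by (rule Bochner_Integration.integral_mono)
        (use int_G int_S pointwise in \<open>auto simp: less_top[symmetric]\<close>)
    also have "\<dots> = 2 * \<delta> * measure M (space M) + measure M (tail n)"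
      by (subst Bochner_Integration.integral_add) (auto simp: less_top[symmetric])
    also have "\<dots> \<le> 2 * \<delta> * measure M (space M) + \<delta>" using n by simp
    also have "\<dots> = \<delta> * (2 * measure M (space M) + 1)" by (simp add: algebra_simps)
    also have "\<dots> = e" using pos by (simp add: \<delta>_def)
    finally show "norm ((\<integral>x. \<phi> x v * cnj (\<phi> x w) \<partial>M)
        - (\<Sum>k<n. of_real (measure M (cell k)) * (\<phi> (d k) v * cnj (\<phi> (d k) w)))) \<le> e"
      by (simp add: G_def)
  qed
qed

section \<open>Controlling the number of terms\<close>

text \<open>
  Approximability with an unknown number of terms already gives a sequence with exactly \<open>N\<close> terms
  at stage \<open>N\<close>: the \<open>N\<close>-th member realises the largest \<open>k \<le> N\<close> for which accuracy \<open>1 / k\<close> is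
  attainable inside \<open>E N\<close>. The case \<open>k = 0\<close> demands nothing and is always attainable, and since
  \<open>E\<close> increases, every \<open>k\<close> is eventually attained.
\<close>
lemma uniform_limit_from_increasing_sets:
  fixes E :: "nat \<Rightarrow> ('a \<Rightarrow> 'b::metric_space) set"
  assumes "mono E" and nonempty: "\<And>N. E N \<noteq> {}"
    and approx: "\<And>e. e > 0 \<Longrightarrow> \<exists>N. \<exists>T\<in>E N. \<forall>x\<in>X. dist (T x) (F x) \<le> e"
  obtains T where "\<And>N. T N \<in> E N" "uniform_limit X T F sequentially"
proof -
  define attains where
    "attains N T k \<longleftrightarrow> T \<in> E N \<and> (k > 0 \<longrightarrow> (\<forall>x\<in>X. dist (T x) (F x) \<le> 1 / real k))" for N T k
  define K where "K N = (GREATEST k. k \<le> N \<and> (\<exists>T. attains N T k))" for N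
  have "\<exists>T. attains N T 0" for N
    using nonempty[of N] by (auto simp: attains_def)
  then have K: "K N \<le> N \<and> (\<exists>T. attains N T (K N))" for N
    unfolding K_def
    using GreatestI_nat[where P = "\<lambda>k. k \<le> N \<and> (\<exists>T. attains N T k)" and k = 0 and b = N] by auto
  then obtain T where T: "\<And>N. attains N (T N) (K N)" by metis
  show thesis
  proof (rule that)
    show "T N \<in> E N" for N using T[of N] by (simp add: attains_def)
    show "uniform_limit X T F sequentially"
    proof (rule uniform_limitI)
      fix e :: real assume "e > 0"
      then obtain k where k: "k > 0" "1 / real k < e"
        by (metis nat_approx_posE zero_less_Suc)
      obtain N0 T0 where N0: "T0 \<in> E N0" "\<forall>x\<in>X. dist (T0 x) (F x) \<le> 1 / real k"
        using approx[of "1 / real k"] k by auto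
      have "\<forall>x\<in>X. dist (T N x) (F x) < e" if "N \<ge> max N0 k" for N
      proof -
        have "T0 \<in> E N" using N0(1) monoD[OF \<open>mono E\<close>, of N0 N] that by auto
        then have "attains N T0 k" using N0(2) by (simp add: attains_def)
        then have "k \<le> K N"
          unfolding K_def using that
            by (intro Greatest_le_nat[where P = "\<lambda>k. k \<le> N \<and> (\<exists>T. attains N T k)" and b = N]) auto
        then have "1 / real (K N) \<le> 1 / real k" using k by (simp add: frac_le)
        moreover have "\<forall>x\<in>X. dist (T N x) (F x) \<le> 1 / real (K N)"
          using T[of N] \<open>k \<le> K N\<close> k by (simp add: attains_def)
        ultimately show ?thesis using k(2) by force
      qed
      then show "\<forall>\<^sub>F N in sequentially. \<forall>x\<in>X. dist (T N x) (F x) < e"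
        unfolding eventually_sequentially by blast
    qed
  qed
qed

definition supported_factor :: "('v::topological_space) set \<Rightarrow> ('v \<Rightarrow> complex) \<Rightarrow> bool" where
  "supported_factor A t \<longleftrightarrow>
     continuous_on A t \<and> bounded (t ` A) \<and> (\<forall>v. v \<notin> A \<longrightarrow> t v = 0)"

text \<open>
  Positive semidefinite Hermitian kernels of rank at most \<open>N\<close>. Factors may be zero, which is what
  makes these sets increase with \<open>N\<close>.
\<close>
definition rank_kernels :: "('v::topological_space) set \<Rightarrow> nat \<Rightarrow> ('v \<times> 'v \<Rightarrow> complex) set" where
  "rank_kernels A N = {T. \<exists>t. (\<forall>j\<in>{1..N}. supported_factor A (t j)) \<and>
     (\<forall>v w. T (v, w) = (\<Sum>j=1..N. t j v * cnj (t j w)))}"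

lemma supported_factor_zero: "supported_factor A (\<lambda>_. 0)"
  by (auto simp: supported_factor_def bounded_iff)

lemma zero_in_rank_kernels: "(\<lambda>_. 0) \<in> rank_kernels A N"
  unfolding rank_kernels_def
  by (rule CollectI, rule exI[of _ "\<lambda>_ _. 0"]) (simp add: supported_factor_zero)

lemma mono_rank_kernels: "mono (rank_kernels A)"
proof (rule monoI, rule subsetI)
  fix M N :: nat and T assume "M \<le> N" and "T \<in> rank_kernels A M"
  then obtain t where t: "\<forall>j\<in>{1..M}. supported_factor A (t j)"
    "\<forall>v w. T (v, w) = (\<Sum>j=1..M. t j v * cnj (t j w))"
    by (auto simp: rank_kernels_def)
  define t' where "t' j = (if j \<le> M then t j else (\<lambda>_. 0))" for j
  have "(\<Sum>j=1..N. t' j v * cnj (t' j w)) = (\<Sum>j=1..M. t j v * cnj (t j w))" for v w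
    by (rule sum.mono_neutral_cong_right) (use \<open>M \<le> N\<close> in \<open>auto simp: t'_def\<close>)
  then show "T \<in> rank_kernels A N"
    using t unfolding rank_kernels_def
    by (intro CollectI exI[of _ t']) (auto simp: t'_def supported_factor_zero)
qed

lemma rank_kernels_continuous_bounded_supported:
  assumes "T \<in> rank_kernels A N"
  shows "continuous_on (A \<times> A) T" "bounded (T ` (A \<times> A))" "\<And>x. x \<notin> A \<times> A \<Longrightarrow> T x = 0"
proof -
  obtain t where t: "\<And>j. j \<in> {1..N} \<Longrightarrow> supported_factor A (t j)"
    and T: "\<And>v w. T (v, w) = (\<Sum>j=1..N. t j v * cnj (t j w))"
    using assms unfolding rank_kernels_def by blast
  have T': "T = (\<lambda>x. \<Sum>j=1..N. t j (fst x) * cnj (t j (snd x)))"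
    using T by auto
  have "continuous_on (A \<times> A) (\<lambda>x. t j (fst x))" "continuous_on (A \<times> A) (\<lambda>x. t j (snd x))"
    if "j \<in> {1..N}" for j
  proof -
    have *: "continuous_on A (t j)" using t[OF that] by (simp add: supported_factor_def)
    show "continuous_on (A \<times> A) (\<lambda>x. t j (fst x))"
      by (rule continuous_on_compose2[OF *]) (auto intro!: continuous_intros)
    show "continuous_on (A \<times> A) (\<lambda>x. t j (snd x))"
      by (rule continuous_on_compose2[OF *]) (auto intro!: continuous_intros)
  qed
  then show "continuous_on (A \<times> A) T"
    unfolding T' by (intro continuous_intros) auto
  show "T x = 0" if "x \<notin> A \<times> A" for x
    unfolding T' by (rule sum.neutral) (use t that in \<open>auto simp: supported_factor_def mem_Times_iff\<close>)
  have "\<exists>B. \<forall>v\<in>A. norm (t j v) \<le> B" if "j \<in> {1..N}" for j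
    using t[OF that] by (auto simp: supported_factor_def bounded_iff)
  then obtain B where B: "\<And>j v. j \<in> {1..N} \<Longrightarrow> v \<in> A \<Longrightarrow> norm (t j v) \<le> B j" by metis
  have "norm (T x) \<le> (\<Sum>j=1..N. B j * B j)" if "x \<in> A \<times> A" for x
    unfolding T'
  proof (rule sum_norm_le)
    fix j assume j: "j \<in> {1..N}"
    have "norm (t j (fst x)) \<le> B j" "norm (t j (snd x)) \<le> B j"
      using that j by (auto intro!: B)
    then show "norm (t j (fst x) * cnj (t j (snd x))) \<le> B j * B j"
      unfolding norm_mult complex_mod_cnj
      by (intro mult_mono) (auto intro: order_trans[OF norm_ge_zero])
  qed
  then show "bounded (T ` (A \<times> A))" unfolding bounded_iff by blast
qed

text \<open>
  Each nonnegative weight of a Riemann sum is split as a product of two equal square roots, one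
  for each factor.
\<close>
lemma Gram_sum_in_rank_kernels:
  fixes \<psi> :: "nat \<Rightarrow> 'v::topological_space \<Rightarrow> complex"
  assumes c: "\<And>k. c k \<ge> 0" and cont: "\<And>k. continuous_on A (\<psi> k)"
    and bound: "\<And>k v. v \<in> A \<Longrightarrow> norm (\<psi> k v) \<le> 1"
  shows "(\<lambda>(v, w). of_real (indicator A v * indicator A w) *
           (\<Sum>k<n. of_real (c k) * (\<psi> k v * cnj (\<psi> k w)))) \<in> rank_kernels A n"
proof -
  define t where "t j v = of_real (indicator A v * sqrt (c (j - 1))) * \<psi> (j - 1) v" for j v
  have "supported_factor A (t j)" for j
    unfolding supported_factor_def
  proof (intro conjI allI impI)
    have "continuous_on A (\<lambda>v. of_real (sqrt (c (j - 1))) * \<psi> (j - 1) v)"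
      by (intro continuous_intros cont)
    then show "continuous_on A (t j)"
      by (rule continuous_on_eq) (simp add: t_def)
    have "norm (t j v) \<le> sqrt (c (j - 1))" if "v \<in> A" for v
      using mult_left_mono[OF bound[OF that, of "j - 1"], of "sqrt (c (j - 1))"] that c[of "j - 1"]
      by (simp add: t_def norm_mult)
    then show "bounded (t j ` A)" unfolding bounded_iff by blast
    show "t j v = 0" if "v \<notin> A" for v using that by (simp add: t_def)
  qed
  moreover have "of_real (indicator A v * indicator A w) *
      (\<Sum>k<n. of_real (c k) * (\<psi> k v * cnj (\<psi> k w))) = (\<Sum>j=1..n. t j v * cnj (t j w))" for v w
  proof -
    have "of_real (indicator A v * indicator A w) * (of_real (c k) * (\<psi> k v * cnj (\<psi> k w)))
        = t (Suc k) v * cnj (t (Suc k) w)" for k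
    proof -
      have "(of_real (c k) :: complex) = of_real (sqrt (c k)) * of_real (sqrt (c k))"
        using c[of k] by (simp flip: of_real_mult)
      then show ?thesis by (simp add: t_def mult_ac)
    qed
    then have "of_real (indicator A v * indicator A w) *
        (\<Sum>k<n. of_real (c k) * (\<psi> k v * cnj (\<psi> k w))) = (\<Sum>k<n. t (Suc k) v * cnj (t (Suc k) w))"
      by (simp add: sum_distrib_left)
    also have "\<dots> = (\<Sum>j=1..n. t j v * cnj (t j w))"
      by (simp add: sum.shift_bounds_Suc_ivl atLeast1_lessThan_eq_remove0
          sum.atLeast1_atMost_eq lessThan_atLeast0)
    finally show ?thesis .
  qed
  ultimately show ?thesis
    unfolding rank_kernels_def by (intro CollectI exI[of _ t]) simp
qed

section \<open>The cross-coefficient as a Gram kernel\<close>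

lemma norm_phase [simp]: "norm (phase lam Cs z v) = 1"
  unfolding phase_def by (simp add: norm_exp_eq_Re)

lemma continuous_on_phase [continuous_intros]:
  assumes "continuous_on S g" "continuous_on S h"
  shows "continuous_on S (\<lambda>x. phase lam Cs (g x) (h x))"
  unfolding phase_def chi_def by (intro continuous_intros assms)

text \<open>
  The parameter is ordered as \<open>(Z', u)\<close>, matching the nesting of the two integrals, so that Fubini
  applies without an exchange of variables.
\<close>
lemma TCC_eq_Gram_kernel:
  assumes s: "prob_density s" and f: "prob_density f"
  defines "M \<equiv> density lborel (\<lambda>(Z', u). ennreal (f Z' * s u))"
  shows "finite_measure M" "sets M = sets borel"
    and "TCC lam Cs amax Z s f (v, w) =
           of_real (indicator (aperture lam amax) v * indicator (aperture lam amax) w) *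
           (\<integral>(Z', u). phase lam Cs (Z + Z') (v + u) * cnj (phase lam Cs (Z + Z') (w + u)) \<partial>M)"
proof -
  define h where "h = (\<lambda>(Z', u). f Z' * s u)"
  have M: "M = density lborel (\<lambda>x. ennreal (h x))"
    by (simp add: M_def h_def case_prod_beta')
  have int_s: "integrable lborel s" and int_f: "integrable lborel f"
    and s0: "AE u in lborel. 0 \<le> s u" and f0: "AE x in lborel. 0 \<le> f x"
    using s f by (auto simp: prob_density_def)
  have [measurable]: "s \<in> borel_measurable borel" "f \<in> borel_measurable borel"
    using int_s int_f by auto
  have h_meas [measurable]: "h \<in> borel_measurable borel"
    unfolding h_def borel_prod[symmetric] by measurable
  have int_h: "integrable lborel h"
    unfolding lborel_prod[symmetric] h_def
    by (rule lborel_pair.Fubini_integrable)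
      (use int_s int_f in \<open>auto simp: abs_mult intro!: integrable_mult_left\<close>)
  \<comment> \<open>\<open>ennreal\<close> truncates negative values, so without this \<open>M\<close> would not have density \<open>h\<close>\<close>
  have h0: "AE x in lborel. 0 \<le> h x"
    unfolding lborel_prod[symmetric]
  proof (rule lborel_pair.AE_pair_measure)
    show "{x \<in> space (lborel \<Otimes>\<^sub>M lborel). 0 \<le> h x} \<in> sets (lborel \<Otimes>\<^sub>M lborel)"
      unfolding h_def by measurable
    show "AE x in lborel. AE y in lborel. 0 \<le> h (x, y)"
      using f0
    proof eventually_elim
      case (elim x)
      show ?case using s0 by eventually_elim (use elim in \<open>simp add: h_def\<close>)
    qed
  qed
  show "finite_measure M"
  proof
    have "emeasure M (space M) = (\<integral>\<^sup>+x. ennreal (h x) \<partial>lborel)"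
      by (simp add: M emeasure_density)
    also have "\<dots> = ennreal (\<integral>x. h x \<partial>lborel)"
      by (rule nn_integral_eq_integral[OF int_h h0])
    finally show "emeasure M (space M) \<noteq> \<infinity>" by simp
  qed
  show "sets M = sets borel" by (simp add: M)
  define \<Phi> where "\<Phi> = (\<lambda>(Z', u). phase lam Cs (Z + Z') (v + u) * cnj (phase lam Cs (Z + Z') (w + u)))"
  have cont: "continuous_on UNIV \<Phi>"
    unfolding \<Phi>_def case_prod_beta by (intro continuous_intros)
  then have \<Phi>_meas [measurable]: "\<Phi> \<in> borel_measurable borel"
    by (rule borel_measurable_continuous_onI)
  have norm_\<Phi>: "norm (\<Phi> x) = 1" for x
    by (simp add: \<Phi>_def case_prod_beta norm_mult)
  have int: "integrable lborel (\<lambda>x. h x *\<^sub>R \<Phi> x)"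
    by (rule Bochner_Integration.integrable_bound[OF int_h]) (auto simp: norm_\<Phi>)
  have "(\<integral>x. \<Phi> x \<partial>M) = (\<integral>x. h x *\<^sub>R \<Phi> x \<partial>lborel)"
    unfolding M by (rule integral_density) (use h0 in auto)
  also have "\<dots> = (LINT Z'|lborel. LINT u|lborel. h (Z', u) *\<^sub>R \<Phi> (Z', u))"
    using lborel_pair.integral_fst'[OF int[folded lborel_prod]] by (simp add: lborel_prod)
  finally show "TCC lam Cs amax Z s f (v, w) =
           of_real (indicator (aperture lam amax) v * indicator (aperture lam amax) w) *
           (\<integral>(Z', u). phase lam Cs (Z + Z') (v + u) * cnj (phase lam Cs (Z + Z') (w + u)) \<partial>M)"
    by (simp add: TCC_def h_def \<Phi>_def scaleR_conv_of_real mult_ac)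
qed

text \<open>
  The aperture is open, hence not compact, but the phase is continuous on the whole plane; the
  Riemann sums are therefore taken on the closed ball and cut off by the indicators afterwards.
\<close>
lemma TCC_rank_kernels_approx:
  assumes "prob_density s" "prob_density f" "e > 0"
  shows "\<exists>N. \<exists>T\<in>rank_kernels (aperture lam amax) N. \<forall>x. dist (T x) (TCC lam Cs amax Z s f x) \<le> e"
proof -
  define M where "M = density lborel (\<lambda>(Z', u). ennreal (f Z' * s u))"
  define A where "A = aperture lam amax"
  define \<phi> where "\<phi> x v = phase lam Cs (Z + fst x) (v + snd x)" for x :: "real \<times> (real^2)" and v
  note M = TCC_eq_Gram_kernel[OF assms(1,2), folded M_def]
  have TCC: "TCC lam Cs amax Z s f (v, w) =
      of_real (indicator A v * indicator A w) * (\<integral>x. \<phi> x v * cnj (\<phi> x w) \<partial>M)" for v w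
    unfolding M(3) by (simp add: \<phi>_def A_def case_prod_beta')
  have "A \<subseteq> cball 0 (amax / lam)" by (auto simp: A_def aperture_def)
  have cont: "continuous_on (UNIV \<times> cball 0 (amax / lam)) (\<lambda>(x, v). \<phi> x v)"
    unfolding \<phi>_def case_prod_beta by (intro continuous_intros)
  have bound: "norm (\<phi> x v) \<le> 1" for x v
    by (simp add: \<phi>_def)
  obtain n :: nat and c :: "nat \<Rightarrow> real" and d :: "nat \<Rightarrow> real \<times> (real^2)"
    where c: "\<And>k. c k \<ge> 0"
    and approx: "\<And>v w. v \<in> cball 0 (amax / lam) \<Longrightarrow> w \<in> cball 0 (amax / lam) \<Longrightarrow>
       norm ((\<integral>x. \<phi> x v * cnj (\<phi> x w) \<partial>M)
         - (\<Sum>k<n. of_real (c k) * (\<phi> (d k) v * cnj (\<phi> (d k) w)))) \<le> e"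
    by (rule Gram_kernel_finite_rank_approx[OF M(1,2) compact_cball cont bound \<open>e > 0\<close>])
      (rule that)
  define T where "T = (\<lambda>(v, w). of_real (indicator A v * indicator A w) *
           (\<Sum>k<n. of_real (c k) * (\<phi> (d k) v * cnj (\<phi> (d k) w))))"
  have "T \<in> rank_kernels A n"
    unfolding T_def
    by (rule Gram_sum_in_rank_kernels[OF c]) (auto simp: \<phi>_def intro!: continuous_intros)
  moreover have "dist (T (v, w)) (TCC lam Cs amax Z s f (v, w)) \<le> e" for v w
  proof (cases "v \<in> A \<and> w \<in> A")
    case True
    then have "v \<in> cball 0 (amax / lam)" "w \<in> cball 0 (amax / lam)"
      using \<open>A \<subseteq> _\<close> by auto
    then show ?thesis
      using approx[of v w] True by (simp add: T_def TCC dist_norm norm_minus_commute)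
  next
    case False
    then show ?thesis using \<open>e > 0\<close> by (auto simp: T_def TCC)
  qed
  ultimately show ?thesis unfolding A_def by fast
qed

theorem proposition2p3:
  fixes lam Cs amax Z :: real
    and s :: "real^2 \<Rightarrow> real" and f :: "real \<Rightarrow> real"
  assumes "lam > 0" and "amax > 0"
    and "prob_density s" and "prob_density f"
    and "\<forall>u. s differentiable (at u)" and "\<forall>x. f differentiable (at x)"
    and "(SUP (v, w) \<in> aperture lam amax \<times> aperture lam amax.
            sup_norm (\<lambda>x. joint_density s f x *\<^sub>R grad (phase_prod lam Cs Z v w) x)) < \<infinity>"
    and "sup_norm (grad (joint_density s f)) < \<infinity>"
  shows "\<exists>T :: nat \<Rightarrow> (real^2) \<times> (real^2) \<Rightarrow> complex.
    uniform_limit UNIV T (TCC lam Cs amax Z s f) sequentially \<and>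
    (\<forall>N. continuous_on (aperture lam amax \<times> aperture lam amax) (T N) \<and>
         bounded (T N ` (aperture lam amax \<times> aperture lam amax)) \<and>
         (\<forall>x. x \<notin> aperture lam amax \<times> aperture lam amax \<longrightarrow> T N x = 0)) \<and>
    (\<forall>N. \<exists>t :: nat \<Rightarrow> real^2 \<Rightarrow> complex.
         (\<forall>j\<in>{1..N}. continuous_on (aperture lam amax) (t j) \<and>
                     bounded (t j ` aperture lam amax) \<and>
                     (\<forall>v. v \<notin> aperture lam amax \<longrightarrow> t j v = 0)) \<and>
         (\<forall>v w. T N (v, w) = (\<Sum>j=1..N. t j v * cnj (t j w))))"
proof -
  obtain T where T: "\<And>N. T N \<in> rank_kernels (aperture lam amax) N"
    and lim: "uniform_limit UNIV T (TCC lam Cs amax Z s f) sequentially"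
  proof (rule uniform_limit_from_increasing_sets[OF mono_rank_kernels])
    show "rank_kernels (aperture lam amax) N \<noteq> {}" for N
      using zero_in_rank_kernels by fast
    show "\<exists>N. \<exists>T\<in>rank_kernels (aperture lam amax) N.
        \<forall>x\<in>UNIV. dist (T x) (TCC lam Cs amax Z s f x) \<le> e" if "e > 0" for e
      using TCC_rank_kernels_approx[OF \<open>prob_density s\<close> \<open>prob_density f\<close> that] by simp
  qed (rule that)
  show ?thesis
  proof (intro exI[of _ T] conjI allI)
    show "uniform_limit UNIV T (TCC lam Cs amax Z s f) sequentially" by (fact lim)
  next
    fix N
    show "continuous_on (aperture lam amax \<times> aperture lam amax) (T N)"
      and "bounded (T N ` (aperture lam amax \<times> aperture lam amax))"
      and "x \<notin> aperture lam amax \<times> aperture lam amax \<longrightarrow> T N x = 0" for x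
      using rank_kernels_continuous_bounded_supported[OF T] by auto
    show "\<exists>t. (\<forall>j\<in>{1..N}. continuous_on (aperture lam amax) (t j) \<and>
                     bounded (t j ` aperture lam amax) \<and>
                     (\<forall>v. v \<notin> aperture lam amax \<longrightarrow> t j v = 0)) \<and>
         (\<forall>v w. T N (v, w) = (\<Sum>j=1..N. t j v * cnj (t j w)))"
      using T[of N] by (simp add: rank_kernels_def supported_factor_def)
  qed
qed

end
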